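(* Let $R$ be a ring with exactly $n$ maximal ideals $\mathfrak{m}_1, \ldots, \mathfrak{m}_n$, and let $a_1, \ldots, a_m \in R$ with $a_1 + \cdots + a_m \in R^\times$. If $\operatorname{char} R/\mathfrak{m}_i = \operatorname{char} R/\mathfrak{m}_j$ for all $i, j$ (e.g. if $R$ contains a field), then there exists $S \subseteq [m]$ with $|S| \le n$ such that $\sum_{i \in S} a_i \in R^\times$.
   Context: All rings are commutative with $1 \ne 0$. $R^\times$ denotes the group of units of $R$, and $\operatorname{char}$ denotes the characteristic. $[m] = \{1, \ldots, m\}$, and $|S|$ denotes the cardinality of $S$. *)

theory Defs
  imports "HOL-Algebra.Algebra"
begin

text \<open>
  HOL-Algebra has no characteristic for carrier-based rings, and \<open>CHAR('a)\<close> is tied to a type,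
  so it does not apply to quotients by a varying ideal.
\<close>

definition characteristic :: "('a, 'b) ring_scheme \<Rightarrow> nat" where
  "characteristic R =
     (if \<exists>k::nat. 0 < k \<and> [k] \<cdot>\<^bsub>R\<^esub> \<one>\<^bsub>R\<^esub> = \<zero>\<^bsub>R\<^esub>
      then LEAST k::nat. 0 < k \<and> [k] \<cdot>\<^bsub>R\<^esub> \<one>\<^bsub>R\<^esub> = \<zero>\<^bsub>R\<^esub>
      else 0)"

end

theory Submission
  imports Defs
begin

text \<open>
  Let \<open>p\<close> be the common residue characteristic and \<open>k\<close> the prime field. The image of the total sum
  in \<open>R/M\<^sub>i\<close> is nonzero, so some \<open>k\<close>-linear functional on \<open>R/M\<^sub>i\<close> does not vanish on it; let
  \<open>c i j\<close> be its value at \<open>a j\<close>. The product over \<open>i\<close> of the sums of \<open>c i j\<close> over \<open>j \<in> S\<close> is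
  nonzero for the full index set, and wherever it is nonzero the sum of \<open>a j\<close> over \<open>j \<in> S\<close> avoids
  every maximal ideal. Each monomial of this product involves at most \<open>n\<close> indices \<open>j\<close>, so by
  inclusion-exclusion it cannot vanish on all \<open>S\<close> of size at most \<open>n\<close>.

  To treat \<open>p = 0\<close> and \<open>p\<close> prime uniformly, functionals have integer coefficients, vanishing means
  divisibility by \<open>p\<close>, and subspaces are replaced by the lattice of relations that the \<open>a j\<close>
  satisfy modulo \<open>M\<^sub>i\<close>.
\<close>

section \<open>Inclusion-exclusion for products of sums\<close>

text \<open>If every small subset failed, induction on \<open>S\<close> would make \<open>p\<close>
  divide each \<open>Q S\<close>: for small \<open>S\<close> the other terms of the expansion belong
  to proper subsets, and for large \<open>S\<close> the sum \<open>Q S\<close> is empty. Summing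
  over all \<open>S \<subseteq> J\<close> contradicts the hypothesis.\<close>

lemma small_subset_prod_not_dvd:
  fixes c :: "'i \<Rightarrow> 'j \<Rightarrow> 'r::comm_ring_1"
  assumes "finite I" "finite J" and "\<not> p dvd (\<Prod>i\<in>I. \<Sum>j\<in>J. c i j)"
  shows "\<exists>S\<subseteq>J. card S \<le> card I \<and> \<not> p dvd (\<Prod>i\<in>I. \<Sum>j\<in>S. c i j)"
proof (rule ccontr)
  assume "\<not> ?thesis"
  then have small: "p dvd (\<Prod>i\<in>I. \<Sum>j\<in>S. c i j)" if "S \<subseteq> J" "card S \<le> card I" for S
    using that by blast
  \<comment> \<open>\<open>Q S\<close> collects the terms of the expanded product in which exactly the indices in \<open>S\<close> occur\<close>
  define Q where "Q S = (\<Sum>f\<in>{f \<in> I \<rightarrow>\<^sub>E S. f ` I = S}. \<Prod>i\<in>I. c i (f i))" for S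
  \<comment> \<open>The choice functions \<open>f\<close> are grouped by their image.\<close>
  have expand: "(\<Prod>i\<in>I. \<Sum>j\<in>T. c i j) = (\<Sum>S\<in>Pow T. Q S)" if "finite T" for T
  proof -
    have "(\<Prod>i\<in>I. \<Sum>j\<in>T. c i j) = (\<Sum>f\<in>I \<rightarrow>\<^sub>E T. \<Prod>i\<in>I. c i (f i))"
      using assms(1) that by (rule prod_sum_PiE)
    also have "\<dots> = (\<Sum>S\<in>Pow T. \<Sum>f\<in>{f \<in> I \<rightarrow>\<^sub>E T. f ` I = S}. \<Prod>i\<in>I. c i (f i))"
      by (rule sum.group[symmetric]) (use assms(1) that in \<open>auto intro!: finite_PiE\<close>)
    also have "\<dots> = (\<Sum>S\<in>Pow T. Q S)"
      unfolding Q_def by (intro sum.cong refl arg_cong2[where f = sum]) (auto simp: PiE_iff)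
    finally show ?thesis .
  qed
  have "p dvd Q S" if "finite S" "S \<subseteq> J" for S
    using that
  proof (induction S rule: finite_psubset_induct)
    case (psubset S)
    show ?case
    proof (cases "card S \<le> card I")
      case True
      have "(\<Prod>i\<in>I. \<Sum>j\<in>S. c i j) = Q S + (\<Sum>T\<in>Pow S - {S}. Q T)"
        using psubset.hyps by (simp add: expand sum.remove[of _ S])
      moreover have "p dvd (\<Sum>T\<in>Pow S - {S}. Q T)"
        by (rule dvd_sum) (use psubset in blast)
      ultimately show ?thesis
        using small[OF psubset.prems True] by (metis dvd_add_left_iff)
    next
      case False
      \<comment> \<open>No map from \<open>I\<close> reaches every element of a set larger than
        \<open>I\<close>.\<close>
      then have "{f \<in> I \<rightarrow>\<^sub>E S. f ` I = S} = {}"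
        using card_image_le[OF assms(1)] by force
      then show ?thesis by (simp only: Q_def sum.empty dvd_0_right)
    qed
  qed
  then have "p dvd (\<Sum>S\<in>Pow J. Q S)"
    using assms(2) by (intro dvd_sum) (auto intro: finite_subset)
  with assms(2,3) show False by (simp add: expand)
qed

section \<open>Integer lattices and separating functionals\<close>

text \<open>
  For \<open>p\<close> prime these are the preimages of the \<open>F\<^sub>p\<close>-subspaces under reduction modulo \<open>p\<close>;
  for \<open>p = 0\<close> they are the intersections of \<open>Q\<close>-subspaces with the integral vectors.
\<close>

definition saturated :: "int \<Rightarrow> ('i \<Rightarrow> int) set \<Rightarrow> bool" where
  "saturated p L \<longleftrightarrow>
     (\<forall>x\<in>L. \<forall>y\<in>L. \<forall>k l. (\<lambda>i. k * x i + l * y i) \<in> L) \<and>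
     (\<forall>x k. \<not> p dvd k \<longrightarrow> (\<lambda>i. k * x i) \<in> L \<longrightarrow> x \<in> L) \<and>
     (\<forall>x. (\<lambda>i. p * x i) \<in> L)"

lemma saturated_comb:
  "saturated p L \<Longrightarrow> x \<in> L \<Longrightarrow> y \<in> L \<Longrightarrow> (\<lambda>i. k * x i + l * y i) \<in> L"
  by (auto simp: saturated_def)

lemma saturated_cancel:
  "saturated p L \<Longrightarrow> \<not> p dvd k \<Longrightarrow> (\<lambda>i. k * x i) \<in> L \<Longrightarrow> x \<in> L"
  by (auto simp: saturated_def)

lemma saturated_dvd:
  assumes "saturated p L" "p dvd k"
  shows "(\<lambda>i. k * x i) \<in> L"
proof -
  from assms(2) obtain q where "k = p * q" ..
  moreover have "(\<lambda>i. p * (q * x i)) \<in> L"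
    using assms(1) by (simp add: saturated_def)
  ultimately show ?thesis by (simp add: mult.assoc)
qed

lemma saturated_sum:
  assumes "saturated p L" "finite J" "\<And>j. j \<in> J \<Longrightarrow> f j \<in> L"
  shows "(\<lambda>i. \<Sum>j\<in>J. k j * f j i) \<in> L"
  using assms(2,3)
proof (induction J rule: finite_induct)
  case empty
  show ?case using saturated_dvd[OF assms(1), of 0] by simp
next
  case (insert j J)
  then show ?case
    using saturated_comb[OF assms(1), of "f j" "\<lambda>i. \<Sum>j\<in>J. k j * f j i" "k j" 1] by simp
qed

lemma prime_or_zero_dvd_mult:
  fixes p :: int
  assumes "Factorial_Ring.prime p \<or> p = 0" "p dvd a * b"
  shows "p dvd a \<or> p dvd b"
  using assms by (auto dest: prime_dvd_multD)

text \<open>This is the span of \<open>L\<close> and \<open>v\<close> up to denominators: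
  \<open>k\<close> replaces a division. Since \<open>p\<close> is prime or 0, products of
  denominators not divisible by \<open>p\<close> are again not divisible by
  \<open>p\<close>.\<close>

lemma saturated_adjoin:
  fixes p :: int
  assumes p: "Factorial_Ring.prime p \<or> p = 0" and L: "saturated p L"
  shows "saturated p {u. \<exists>k l. \<not> p dvd k \<and> (\<lambda>i. k * u i - l * v i) \<in> L}" (is "saturated p ?W")
  unfolding saturated_def
proof (intro conjI ballI allI impI)
  fix x y k l
  assume "x \<in> ?W" "y \<in> ?W"
  then obtain kx lx ky ly where *: "\<not> p dvd kx" "(\<lambda>i. kx * x i - lx * v i) \<in> L"
    "\<not> p dvd ky" "(\<lambda>i. ky * y i - ly * v i) \<in> L"
    by blast
  have "\<not> p dvd kx * ky"
    using * prime_or_zero_dvd_mult[OF p] by blast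
  moreover have "(\<lambda>i. (kx * ky) * (k * x i + l * y i) - (k * ky * lx + l * kx * ly) * v i) \<in> L"
    using saturated_comb[OF L *(2,4), of "k * ky" "l * kx"] by (simp add: algebra_simps)
  ultimately show "(\<lambda>i. k * x i + l * y i) \<in> ?W" by blast
next
  fix x k
  assume k: "\<not> p dvd k" and "(\<lambda>i. k * x i) \<in> ?W"
  then obtain k' l where "\<not> p dvd k'" "(\<lambda>i. k' * (k * x i) - l * v i) \<in> L"
    by blast
  then show "x \<in> ?W"
    using k prime_or_zero_dvd_mult[OF p] by (auto simp flip: mult.assoc)
next
  fix x
  have "\<not> p dvd 1" using p by auto
  moreover have "(\<lambda>i. 1 * (p * x i) - 0 * v i) \<in> L"
    using saturated_dvd[OF L, of p x] by simp
  ultimately show "(\<lambda>i. p * x i) \<in> ?W" by blast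
qed

text \<open>One step towards a hyperplane avoiding \<open>t\<close>: either \<open>v\<close> is
  already proportional to \<open>t\<close> modulo \<open>L\<close>, or \<open>v\<close> can be
  adjoined without capturing \<open>t\<close>, and then \<open>v\<close> is 0 modulo
  \<open>W\<close>.\<close>

lemma saturated_extend:
  fixes p :: int
  assumes p: "Factorial_Ring.prime p \<or> p = 0" and L: "saturated p L" and t: "t \<notin> L"
  shows "\<exists>W. L \<subseteq> W \<and> saturated p W \<and> t \<notin> W \<and> (\<exists>k l. \<not> p dvd l \<and> (\<lambda>i. l * v i - k * t i) \<in> W)"
proof (cases "\<exists>k l. \<not> p dvd l \<and> (\<lambda>i. l * v i - k * t i) \<in> L")
  case True
  with L t show ?thesis by blast
next
  case False
  define W where "W = {u. \<exists>k l. \<not> p dvd k \<and> (\<lambda>i. k * u i - l * v i) \<in> L}"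
  have one: "\<not> p dvd 1" using p by auto
  have "saturated p W"
    unfolding W_def using p L by (rule saturated_adjoin)
  moreover have "L \<subseteq> W"
  proof
    fix x assume "x \<in> L"
    then have "(\<lambda>i. 1 * x i - 0 * v i) \<in> L" by simp
    with one show "x \<in> W" unfolding W_def by blast
  qed
  moreover have "t \<notin> W"
  proof
    assume "t \<in> W"
    then obtain k l where k: "\<not> p dvd k" and kl: "(\<lambda>i. k * t i - l * v i) \<in> L"
      unfolding W_def by blast
    show False
    \<comment> \<open>If \<open>p\<close> divides \<open>l\<close>, the \<open>v\<close> term lies
      in \<open>L\<close> and \<open>t\<close> would too; otherwise the relation, negated, expresses
      \<open>v\<close> through \<open>t\<close>, which this case excludes.\<close>
    proof (cases "p dvd l")
      case True
      then have "(\<lambda>i. k * t i) \<in> L"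
        using saturated_comb[OF L kl saturated_dvd[OF L], of l 1 1 v] by simp
      with t show False using saturated_cancel[OF L k] by blast
    next
      assume "\<not> p dvd l"
      moreover have "(\<lambda>i. l * v i - k * t i) \<in> L"
        using saturated_comb[OF L kl kl, of "-1" 0] by simp
      ultimately show False using False by blast
    qed
  qed
  moreover have "\<exists>k l. \<not> p dvd l \<and> (\<lambda>i. l * v i - k * t i) \<in> W"
  proof -
    have "(\<lambda>i. 1 * v i - 1 * v i) \<in> L"
      using saturated_dvd[OF L, of 0] by simp
    with one have "v \<in> W" unfolding W_def by blast
    then have "(\<lambda>i. 1 * v i - 0 * t i) \<in> W" by simp
    with one show ?thesis by blast
  qed
  ultimately show ?thesis by blast
qed

text \<open>Iterating the extension keeps the earlier relations, because the lattice only
  grows.\<close>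

lemma saturated_extend_finite:
  fixes p :: int
  assumes p: "Factorial_Ring.prime p \<or> p = 0" and "saturated p L" "t \<notin> L" "finite J"
  shows "\<exists>W. L \<subseteq> W \<and> saturated p W \<and> t \<notin> W \<and>
    (\<forall>j\<in>J. \<exists>k l. \<not> p dvd l \<and> (\<lambda>i. l * v j i - k * t i) \<in> W)"
  using assms(4)
proof (induction J rule: finite_induct)
  case empty
  with assms(2,3) show ?case by blast
next
  case (insert j J)
  then obtain W where W: "L \<subseteq> W" "saturated p W" "t \<notin> W"
    "\<forall>j\<in>J. \<exists>k l. \<not> p dvd l \<and> (\<lambda>i. l * v j i - k * t i) \<in> W"
    by blast
  from saturated_extend[OF p W(2,3), of "v j"]
  obtain W' where "W \<subseteq> W'" "saturated p W'" "t \<notin> W'"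
    "\<exists>k l. \<not> p dvd l \<and> (\<lambda>i. l * v j i - k * t i) \<in> W'"
    by blast
  with W(1,4) show ?case by (intro exI[of _ W']) blast
qed

lemma prime_or_zero_dvd_prod:
  fixes p :: int
  assumes "Factorial_Ring.prime p \<or> p = 0" "finite A" "p dvd prod f A"
  shows "\<exists>x\<in>A. p dvd f x"
  using assms by (auto simp: prime_dvd_prod_iff)

text \<open>Once \<open>L\<close> is enlarged to \<open>W\<close> so that every unit vector is
  proportional to \<open>t\<close> modulo \<open>W\<close>, the functional is the coordinate along
  \<open>t\<close>.\<close>

lemma saturated_separate:
  fixes p :: int
  assumes p: "Factorial_Ring.prime p \<or> p = 0" and L: "saturated p L" and t: "t \<notin> L"
    and J: "finite J" and supp: "\<And>i. i \<notin> J \<Longrightarrow> t i = 0"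
  shows "\<exists>c. (\<forall>x\<in>L. (\<forall>i. i \<notin> J \<longrightarrow> x i = 0) \<longrightarrow> p dvd (\<Sum>j\<in>J. c j * x j)) \<and>
    \<not> p dvd (\<Sum>j\<in>J. c j * t j)"
proof -
  define e :: "'a \<Rightarrow> 'a \<Rightarrow> int" where "e j i = (if i = j then 1 else 0)" for i j
  from saturated_extend_finite[OF p L t J, of e] obtain W
    where LW: "L \<subseteq> W" and W: "saturated p W" and tW: "t \<notin> W"
      and "\<forall>j\<in>J. \<exists>k l. \<not> p dvd l \<and> (\<lambda>i. l * e j i - k * t i) \<in> W"
    by blast
  then obtain k l where l: "\<And>j. j \<in> J \<Longrightarrow> \<not> p dvd l j"
    and kl: "\<And>j. j \<in> J \<Longrightarrow> (\<lambda>i. l j * e j i - k j * t i) \<in> W"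
    by metis
  define N where "N = prod l J"
  have N: "\<not> p dvd N"
    unfolding N_def using prime_or_zero_dvd_prod[OF p J] l by blast
  \<comment> \<open>modulo \<open>W\<close> the \<open>j\<close>-th unit vector is \<open>(k j / l j) t\<close>; clearing denominators gives \<open>c\<close>\<close>
  define c where "c j = k j * prod l (J - {j})" for j
  have Nl: "N = prod l (J - {j}) * l j" if "j \<in> J" for j
    using J that by (simp add: N_def prod.remove mult.commute)
  \<comment> \<open>Expanding \<open>x\<close> in unit vectors gives \<open>N x = c(x) t\<close>
    modulo \<open>W\<close>, where \<open>c(x)\<close> is the value of the functional. As
    \<open>t \<notin> W\<close>, \<open>x \<in> L\<close> forces \<open>p\<close> to divide
    \<open>c(x)\<close>, while \<open>x = t\<close> forces \<open>p\<close> not to divide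
    \<open>c(t)\<close>.\<close>
  have key: "(\<lambda>i. N * x i - (\<Sum>j\<in>J. c j * x j) * t i) \<in> W" if "\<forall>i. i \<notin> J \<longrightarrow> x i = 0" for x
  proof -
    have "(\<lambda>i. \<Sum>j\<in>J. (x j * prod l (J - {j})) * (l j * e j i - k j * t i)) \<in> W"
      using saturated_sum[OF W J kl] .
    moreover have "(\<Sum>j\<in>J. (x j * prod l (J - {j})) * (l j * e j i - k j * t i)) =
        N * x i - (\<Sum>j\<in>J. c j * x j) * t i" for i
    proof -
      have "(\<Sum>j\<in>J. (x j * prod l (J - {j})) * (l j * e j i - k j * t i)) =
          (\<Sum>j\<in>J. N * x j * e j i - c j * x j * t i)"
        by (rule sum.cong) (simp_all add: Nl c_def algebra_simps)
      also have "\<dots> = (\<Sum>j\<in>J. N * x j * e j i) - (\<Sum>j\<in>J. c j * x j) * t i"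
        by (simp add: sum_subtractf sum_distrib_right)
      also have "(\<Sum>j\<in>J. N * x j * e j i) = N * x i"
        using J that by (auto simp: e_def if_distrib sum.delta cong: if_cong)
      finally show ?thesis .
    qed
    ultimately show ?thesis by simp
  qed
  have "p dvd (\<Sum>j\<in>J. c j * x j)" if "x \<in> L" "\<forall>i. i \<notin> J \<longrightarrow> x i = 0" for x
  proof (rule ccontr)
    assume nd: "\<not> p dvd (\<Sum>j\<in>J. c j * x j)"
    have "(\<lambda>i. (\<Sum>j\<in>J. c j * x j) * t i) \<in> W"
      using saturated_comb[OF W _ key[OF that(2)], of x N "-1"] that(1) LW by auto
    with tW show False using saturated_cancel[OF W nd] by blast
  qed
  moreover have "\<not> p dvd (\<Sum>j\<in>J. c j * t j)"
  proof
    assume dvd: "p dvd (\<Sum>j\<in>J. c j * t j)"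
    have "(\<lambda>i. N * t i) \<in> W"
      using saturated_comb[OF W key saturated_dvd[OF W dvd], of t 1 1 t] supp by simp
    with tW show False using saturated_cancel[OF W N] by blast
  qed
  ultimately show ?thesis by blast
qed

section \<open>Characteristic and integer multiples of one\<close>

lemma (in ring) int_one_mult:
  "add_pow R (k * l) \<one> = add_pow R k \<one> \<otimes> add_pow R l \<one>" for k l :: int
  by (simp add: add_pow_ldistr_int add.int_pow_pow mult.commute)

text \<open>The characteristic generates the kernel of the map from the integers to
  \<open>R\<close>. Divisibility covers characteristic 0 as well, since 0 divides only 0.\<close>

lemma (in ring) int_one_eq_zero_iff:
  "add_pow R k \<one> = \<zero> \<longleftrightarrow> int (characteristic R) dvd k" for k :: int
proof -
  define p where "p = characteristic R"
  have nat_int: "add_pow R (int q) \<one> = add_pow R q \<one>" for q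
    by (simp add: add_pow_int_ge)
  have p0: "add_pow R (int p) \<one> = \<zero>"
    unfolding nat_int p_def characteristic_def
    by (auto intro: LeastI2_ex)
  have least: "q = 0" if "add_pow R q \<one> = \<zero>" "q < p" for q :: nat
    using that not_less_Least unfolding p_def characteristic_def
    by (fastforce split: if_splits)
  have pos: "p > 0" if "add_pow R q \<one> = \<zero>" "q > 0" for q :: nat
    using that unfolding p_def characteristic_def by (auto intro: LeastI2_ex)
  show ?thesis
    unfolding p_def[symmetric]
  proof
    assume "int p dvd k"
    then obtain q where "k = int p * q" ..
    then show "add_pow R k \<one> = \<zero>" by (simp add: int_one_mult p0)
  next
    assume k: "add_pow R k \<one> = \<zero>"
    show "int p dvd k"
    proof (cases "p = 0")
      case True
      have "add_pow R (nat \<bar>k\<bar>) \<one> = \<zero>"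
        using k by (cases "k \<ge> 0") (simp_all add: add_pow_int_ge add_pow_int_lt)
      then show ?thesis using pos True by fastforce
    next
      case False
      have "add_pow R k \<one> = add_pow R (int p * (k div int p) + k mod int p) \<one>" by simp
      also have "\<dots> = add_pow R (k mod int p) \<one>"
        by (simp only: add.int_pow_mult one_closed int_one_mult p0) simp
      finally have "add_pow R (nat (k mod int p)) \<one> = \<zero>"
        using k False by (simp add: add_pow_int_ge)
      then have "nat (k mod int p) = 0"
        using False by (intro least) (simp_all add: nat_less_iff)
      then have "k mod int p = 0"
        using False pos_mod_sign[of "int p" k] by linarith
      then show ?thesis by (rule mod_0_imp_dvd)
    qed
  qed
qed

lemma (in domain) characteristic_prime_or_zero:
  "Factorial_Ring.prime (int (characteristic R)) \<or> int (characteristic R) = 0"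
proof (cases "characteristic R = 0")
  case False
  have "prime_elem (int (characteristic R))"
  proof (rule prime_elemI)
    show "\<not> int (characteristic R) dvd 1"
      using int_one_eq_zero_iff[of 1] by simp
    fix a b assume "int (characteristic R) dvd a * b"
    then show "int (characteristic R) dvd a \<or> int (characteristic R) dvd b"
      unfolding int_one_eq_zero_iff[symmetric] int_one_mult using integral by simp
  qed (use False in simp)
  then show ?thesis by (simp add: prime_def)
qed simp

text \<open>Residue characteristics become statements about elements of \<open>R\<close>, so later
  arguments need no cosets.\<close>

lemma (in ring) int_one_mem_ideal_iff:
  fixes k :: int
  assumes "ideal I R"
  shows "add_pow R k \<one> \<in> I \<longleftrightarrow> int (characteristic (R Quot I)) dvd k"
proof -
  interpret ideal I R by fact
  interpret Q: ring "R Quot I" by (rule quotient_is_ring)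
  interpret h: ring_hom_ring R "R Quot I" "(+>) I" by (rule rcos_ring_hom_ring)
  have "I +> add_pow R k \<one> = add_pow (R Quot I) k \<one>\<^bsub>R Quot I\<^esub>"
    using h.a_group_hom group_hom.hom_int_pow[of "add_monoid R" "add_monoid (R Quot I)" "(+>) I" \<one> k]
    by (simp add: add_pow_def)
  moreover have "add_pow R k \<one> \<in> I \<longleftrightarrow> I +> add_pow R k \<one> = I"
    using rcos_const_imp_mem[of "add_pow R k \<one>"] a_rcos_zero[OF assms, of "add_pow R k \<one>"]
    by (metis add.int_pow_closed one_closed)
  moreover have "\<zero>\<^bsub>R Quot I\<^esub> = I"
    by (simp only: FactRing_def ring_record_simps)
  ultimately show ?thesis
    using Q.int_one_eq_zero_iff[of k] by metis
qed

section \<open>Maximal ideals, units and subfields\<close>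

lemma (in ring) maximalideal_exists:
  assumes "ideal I R" "\<one> \<notin> I"
  shows "\<exists>M. maximalideal M R \<and> I \<subseteq> M"
proof -
  define A where "A = {J. ideal J R \<and> I \<subseteq> J \<and> \<one> \<notin> J}"
  have "\<exists>M\<in>A. \<forall>J\<in>A. M \<subseteq> J \<longrightarrow> J = M"
  \<comment> \<open>A union of a chain of ideals avoiding \<open>\<one>\<close> is again such an
    ideal.\<close>
  proof (rule subset_Zorn_nonempty)
    show "A \<noteq> {}" using assms by (auto simp: A_def)
    fix C assume C: "C \<noteq> {}" "subset.chain A C"
    then have "subset.chain {J. ideal J R} C"
      by (auto simp: A_def pred_on.chain_def)
    then have "ideal (\<Union>C) R"
      using chain_Union_is_ideal[of C] C(1) by simp
    with C show "\<Union>C \<in> A"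
      by (auto simp: A_def pred_on.chain_def)
  qed
  then obtain M where M: "ideal M R" "I \<subseteq> M" "\<one> \<notin> M"
    and max: "\<And>J. ideal J R \<Longrightarrow> I \<subseteq> J \<Longrightarrow> \<one> \<notin> J \<Longrightarrow> M \<subseteq> J \<Longrightarrow> J = M"
    by (auto simp: A_def)
  have "maximalideal M R"
  proof (rule maximalidealI)
    show "carrier R \<noteq> M" using M(3) by blast
    fix J assume J: "ideal J R" "M \<subseteq> J"
    then show "J = M \<or> J = carrier R"
      using max[of J] M(2) ideal.one_imp_carrier[of J R] by blast
  qed (rule M)
  with M(2) show ?thesis by blast
qed

lemma (in cring) Units_iff_no_maximalideal:
  assumes "x \<in> carrier R"
  shows "x \<in> Units R \<longleftrightarrow> (\<forall>M. maximalideal M R \<longrightarrow> x \<notin> M)"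
proof
  assume "x \<in> Units R"
  then have inv: "x \<otimes> inv x = \<one>" "inv x \<in> carrier R" by auto
  show "\<forall>M. maximalideal M R \<longrightarrow> x \<notin> M"
  proof (intro allI impI notI)
    fix M assume M: "maximalideal M R" and "x \<in> M"
    interpret maximalideal M R by fact
    show False
      using I_r_closed[OF \<open>x \<in> M\<close> inv(2)] inv(1) one_imp_carrier I_notcarr by simp
  qed
next
  assume max: "\<forall>M. maximalideal M R \<longrightarrow> x \<notin> M"
  show "x \<in> Units R"
  proof (rule ccontr)
    assume "x \<notin> Units R"
    then have "\<one> \<notin> PIdl x"
      using assms by (auto simp: cgenideal_def Units_def m_comm)
    then obtain M where "maximalideal M R" "PIdl x \<subseteq> M"
      using maximalideal_exists[OF cgenideal_ideal[OF assms]] by blast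
    with max show False using cgenideal_self[OF assms] by blast
  qed
qed

text \<open>A nonzero integer multiple of \<open>\<one>\<close> lies in \<open>K\<close>, hence is
  invertible and cannot lie in the proper ideal \<open>I\<close>. So the same integers vanish in
  \<open>R\<close> and in \<open>R Quot I\<close>.\<close>

lemma (in cring) characteristic_Quot_subfield:
  assumes "subfield K R" "ideal I R" "\<one> \<notin> I"
  shows "characteristic (R Quot I) = characteristic R"
proof -
  interpret ideal I R by fact
  interpret K: subfield K R by fact
  have mem: "add_pow R k \<one> \<in> K" for k :: int
  proof -
    have "add_pow R n \<one> \<in> K" for n :: nat
      by (induction n) (auto simp: K.one_closed subringE[OF subfieldE(1)[OF assms(1)]])
    then show ?thesis
      by (cases "k \<ge> 0") (simp_all add: add_pow_int_ge add_pow_int_lt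
          subringE(5)[OF subfieldE(1)[OF assms(1)]])
  qed
  have "add_pow R k \<one> \<in> I \<longleftrightarrow> add_pow R k \<one> = \<zero>" for k :: int
  proof
    assume k: "add_pow R k \<one> \<in> I"
    show "add_pow R k \<one> = \<zero>"
    proof (rule ccontr)
      assume "add_pow R k \<one> \<noteq> \<zero>"
      then have *: "add_pow R k \<one> \<in> K - {\<zero>}" using mem by simp
      have "inv (add_pow R k \<one>) \<in> carrier R"
        using subfield_m_inv(1)[OF assms(1) *] subfieldE(3)[OF assms(1)] by blast
      then have "add_pow R k \<one> \<otimes> inv (add_pow R k \<one>) \<in> I"
        using k I_r_closed by blast
      then show False using subfield_m_inv(2)[OF assms(1) *] assms(3) by simp
    qed
  qed (simp add: additive_subgroup.zero_closed is_additive_subgroup)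
  then have "int (characteristic (R Quot I)) dvd k \<longleftrightarrow> int (characteristic R) dvd k" for k
    using int_one_eq_zero_iff[of k] int_one_mem_ideal_iff[OF assms(2), of k] by blast
  \<comment> \<open>Testing each characteristic against the other gives mutual divisibility.\<close>
  from this[of "int (characteristic (R Quot I))"] this[of "int (characteristic R)"]
  show ?thesis by (simp add: dvd_antisym)
qed

section \<open>Functionals separating subset sums from a prime ideal\<close>

text \<open>Scaling a vector by \<open>k\<close> multiplies its combination by the image of
  \<open>k\<close> in \<open>R\<close>. Cancellation is then primality of \<open>P\<close>, and the
  multiples of the characteristic are relations because its image lies in \<open>P\<close>.\<close>

lemma (in cring) saturated_relations:
  assumes P: "primeideal P R" and J: "finite J" and a: "\<And>j. j \<in> J \<Longrightarrow> a j \<in> carrier R"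
  shows "saturated (int (characteristic (R Quot P))) {x. (\<Oplus>j\<in>J. add_pow R (x j) (a j)) \<in> P}"
proof -
  interpret primeideal P R by fact
  have cl: "(\<Oplus>j\<in>J. add_pow R (x j) (a j)) \<in> carrier R" for x :: "_ \<Rightarrow> int"
    using a by (intro finsum_closed) auto
  have scale: "(\<Oplus>j\<in>J. add_pow R (k * x j) (a j)) = add_pow R k \<one> \<otimes> (\<Oplus>j\<in>J. add_pow R (x j) (a j))" for k :: int and x
  proof -
    have "(\<Oplus>j\<in>J. add_pow R (k * x j) (a j)) = (\<Oplus>j\<in>J. add_pow R k \<one> \<otimes> add_pow R (x j) (a j))"
      by (rule finsum_cong') (auto simp: a add_pow_ldistr_int add.int_pow_pow mult.commute)
    also have "\<dots> = add_pow R k \<one> \<otimes> (\<Oplus>j\<in>J. add_pow R (x j) (a j))"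
      using J a by (intro finsum_rdistr[symmetric]) auto
    finally show ?thesis .
  qed
  have add: "(\<Oplus>j\<in>J. add_pow R (x j + y j) (a j)) = (\<Oplus>j\<in>J. add_pow R (x j) (a j)) \<oplus> (\<Oplus>j\<in>J. add_pow R (y j) (a j))"
    for x y :: "_ \<Rightarrow> int"
  proof -
    have "(\<Oplus>j\<in>J. add_pow R (x j + y j) (a j)) =
        (\<Oplus>j\<in>J. add_pow R (x j) (a j) \<oplus> add_pow R (y j) (a j))"
      by (rule finsum_cong') (auto simp: a add.int_pow_mult)
    also have "\<dots> = (\<Oplus>j\<in>J. add_pow R (x j) (a j)) \<oplus> (\<Oplus>j\<in>J. add_pow R (y j) (a j))"
      using a by (intro finsum_addf) auto
    finally show ?thesis .
  qed
  show ?thesis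
    unfolding saturated_def mem_Collect_eq Ball_def scale add
  proof (intro conjI allI impI)
    fix x y :: "'c \<Rightarrow> int" and k l :: int
    assume "(\<Oplus>j\<in>J. add_pow R (x j) (a j)) \<in> P" "(\<Oplus>j\<in>J. add_pow R (y j) (a j)) \<in> P"
    then show "add_pow R k \<one> \<otimes> (\<Oplus>j\<in>J. add_pow R (x j) (a j)) \<oplus>
        add_pow R l \<one> \<otimes> (\<Oplus>j\<in>J. add_pow R (y j) (a j)) \<in> P"
      by (intro a_closed I_l_closed add.int_pow_closed one_closed)
  next
    fix x :: "'c \<Rightarrow> int" and k :: int
    assume "\<not> int (characteristic (R Quot P)) dvd k"
      "add_pow R k \<one> \<otimes> (\<Oplus>j\<in>J. add_pow R (x j) (a j)) \<in> P"
    then show "(\<Oplus>j\<in>J. add_pow R (x j) (a j)) \<in> P"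
      using I_prime[OF _ cl, of "add_pow R k \<one>" x] int_one_mem_ideal_iff[OF is_ideal, of k] by simp
  next
    fix x :: "'c \<Rightarrow> int"
    show "add_pow R (int (characteristic (R Quot P))) \<one> \<otimes> (\<Oplus>j\<in>J. add_pow R (x j) (a j)) \<in> P"
      by (rule I_r_closed[OF _ cl]) (simp only: int_one_mem_ideal_iff[OF is_ideal] dvd_refl)
  qed
qed

lemma (in cring) separating_functional:
  assumes P: "primeideal P R" and J: "finite J" and a: "\<And>j. j \<in> J \<Longrightarrow> a j \<in> carrier R"
    and notin: "(\<Oplus>j\<in>J. a j) \<notin> P"
  shows "\<exists>c. \<not> int (characteristic (R Quot P)) dvd (\<Sum>j\<in>J. c j) \<and>
    (\<forall>S\<subseteq>J. (\<Oplus>j\<in>S. a j) \<in> P \<longrightarrow> int (characteristic (R Quot P)) dvd (\<Sum>j\<in>S. c j))"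
proof -
  let ?p = "int (characteristic (R Quot P))"
  define L :: "('c \<Rightarrow> int) set" where "L = {x. (\<Oplus>j\<in>J. add_pow R (x j) (a j)) \<in> P}"
  \<comment> \<open>Indicator vectors turn subset sums into integer combinations;
    \<open>ind J\<close> is the vector to be separated from the relations \<open>L\<close>.\<close>
  define ind :: "'c set \<Rightarrow> 'c \<Rightarrow> int" where "ind S j = (if j \<in> S then 1 else 0)" for S j
  have ind: "(\<Oplus>j\<in>J. add_pow R (ind S j) (a j)) = (\<Oplus>j\<in>S. a j)" if "S \<subseteq> J" for S
  proof -
    have "(\<Oplus>j\<in>S. a j) = (\<Oplus>j\<in>J. add_pow R (ind S j) (a j))"
      by (rule add.finprod_mono_neutral_cong_left) (use that J a in \<open>auto simp: ind_def add_pow_int_ge\<close>)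
    then show ?thesis ..
  qed
  have ind_sum: "(\<Sum>j\<in>J. c j * ind S j) = (\<Sum>j\<in>S. c j)" if "S \<subseteq> J" for S c
    using that J by (intro sum.mono_neutral_cong_right) (auto simp: ind_def)
  have "domain (R Quot P)"
    using primeideal.quotient_is_domain[OF P] .
  then have p: "Factorial_Ring.prime ?p \<or> ?p = 0"
    by (rule domain.characteristic_prime_or_zero)
  have "saturated ?p L"
    unfolding L_def by (rule saturated_relations[OF P J a])
  moreover have "ind J \<notin> L"
    using notin by (simp add: L_def ind)
  ultimately obtain c where c: "\<And>x. x \<in> L \<Longrightarrow> \<forall>i. i \<notin> J \<longrightarrow> x i = 0 \<Longrightarrow> ?p dvd (\<Sum>j\<in>J. c j * x j)"
      "\<not> ?p dvd (\<Sum>j\<in>J. c j * ind J j)"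
    using saturated_separate[OF p _ _ J, of L "ind J"] by (auto simp: ind_def)
  have "?p dvd (\<Sum>j\<in>S. c j)" if "S \<subseteq> J" "(\<Oplus>j\<in>S. a j) \<in> P" for S
  proof -
    have "ind S \<in> L" "\<forall>i. i \<notin> J \<longrightarrow> ind S i = 0"
      using that by (auto simp: L_def ind) (auto simp: ind_def)
    from c(1)[OF this] show ?thesis using that(1) by (simp add: ind_sum)
  qed
  with c(2) show ?thesis by (auto simp: ind_sum)
qed

section \<open>Small subsets with unit sum\<close>

lemma (in cring) small_subset_sum_Units:
  assumes I: "finite I" and M: "M ` I = {P. maximalideal P R}"
    and char: "\<And>i. i \<in> I \<Longrightarrow> characteristic (R Quot M i) = p"
    and J: "finite J" and a: "\<And>j. j \<in> J \<Longrightarrow> a j \<in> carrier R"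
    and unit: "(\<Oplus>j\<in>J. a j) \<in> Units R"
  shows "\<exists>S\<subseteq>J. card S \<le> card I \<and> (\<Oplus>j\<in>S. a j) \<in> Units R"
proof (cases "I = {}")
  \<comment> \<open>With no maximal ideals even \<open>\<zero>\<close> is a unit, so the empty sum
    works.\<close>
  case True
  then have "\<zero> \<in> Units R"
    using Units_iff_no_maximalideal[of \<zero>] M by auto
  then show ?thesis by (intro exI[of _ "{}"]) simp
next
  case False
  have max: "maximalideal (M i) R" if "i \<in> I" for i
    using M that by blast
  have closed: "(\<Oplus>j\<in>S. a j) \<in> carrier R" if "S \<subseteq> J" for S
    using a that by (intro finsum_closed) auto
  have "\<exists>c. \<not> int p dvd (\<Sum>j\<in>J. c j) \<and>
      (\<forall>S\<subseteq>J. (\<Oplus>j\<in>S. a j) \<in> M i \<longrightarrow> int p dvd (\<Sum>j\<in>S. c j))" if "i \<in> I" for i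
    using separating_functional[OF maximalideal_prime[OF max[OF that]] J a] that
      unit closed[of J] Units_iff_no_maximalideal max char by simp
  then obtain c where c: "\<And>i. i \<in> I \<Longrightarrow> \<not> int p dvd (\<Sum>j\<in>J. c i j)"
    "\<And>i S. i \<in> I \<Longrightarrow> S \<subseteq> J \<Longrightarrow> (\<Oplus>j\<in>S. a j) \<in> M i \<Longrightarrow> int p dvd (\<Sum>j\<in>S. c i j)"
    by metis
  have "\<not> int p dvd (\<Prod>i\<in>I. \<Sum>j\<in>J. c i j)"
  proof -
    \<comment> \<open>Some residue ring is needed to see that \<open>p\<close> is prime or 0, so
      that a product of non-multiples of \<open>p\<close> is a non-multiple.\<close>
    obtain i where i: "i \<in> I" using False by blast
    interpret D: domain "R Quot M i"
      using primeideal.quotient_is_domain[OF maximalideal_prime[OF max[OF i]]] .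
    show ?thesis
      using prime_or_zero_dvd_prod[OF D.characteristic_prime_or_zero I] c(1) i char by metis
  qed
  then obtain S where S: "S \<subseteq> J" "card S \<le> card I" "\<not> int p dvd (\<Prod>i\<in>I. \<Sum>j\<in>S. c i j)"
    using small_subset_prod_not_dvd[OF I J] by blast
  have "(\<Oplus>j\<in>S. a j) \<notin> M i" if "i \<in> I" for i
  proof
    assume "(\<Oplus>j\<in>S. a j) \<in> M i"
    from c(2)[OF that S(1) this] show False
      using S(3) dvd_trans[OF _ dvd_prodI[OF I that, of "\<lambda>i. \<Sum>j\<in>S. c i j"]] by simp
  qed
  then have "(\<Oplus>j\<in>S. a j) \<in> Units R"
    using Units_iff_no_maximalideal[OF closed[OF S(1)]] M by (metis imageE mem_Collect_eq)
  with S show ?thesis by blast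
qed

theorem theorem6:
  fixes R :: "('a, 'b) ring_scheme"
    and n m :: nat
    and M :: "nat \<Rightarrow> 'a set"
    and a :: "nat \<Rightarrow> 'a"
  assumes "cring R" and "\<one>\<^bsub>R\<^esub> \<noteq> \<zero>\<^bsub>R\<^esub>"
    and "bij_betw M {1..n} {I. maximalideal I R}"
    and "\<And>i. i \<in> {1..m} \<Longrightarrow> a i \<in> carrier R"
    and "(\<Oplus>\<^bsub>R\<^esub>i\<in>{1..m}. a i) \<in> Units R"
  shows "((\<forall>i\<in>{1..n}. \<forall>j\<in>{1..n}.
             characteristic (R Quot M i) = characteristic (R Quot M j)) \<longrightarrow>
           (\<exists>S\<subseteq>{1..m}. card S \<le> n \<and> (\<Oplus>\<^bsub>R\<^esub>i\<in>S. a i) \<in> Units R)) \<and>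
         ((\<exists>K. subfield K R) \<longrightarrow>
           (\<forall>i\<in>{1..n}. \<forall>j\<in>{1..n}.
             characteristic (R Quot M i) = characteristic (R Quot M j)))"
proof (intro conjI impI)
  interpret cring R by fact
  have M: "M ` {1..n} = {I. maximalideal I R}"
    using assms(3) by (rule bij_betw_imp_surj_on)
  {
    assume "\<forall>i\<in>{1..n}. \<forall>j\<in>{1..n}. characteristic (R Quot M i) = characteristic (R Quot M j)"
    \<comment> \<open>The value at index 1 serves as the common characteristic; for
      \<open>n = 0\<close> the claim is vacuous.\<close>
    then have "characteristic (R Quot M i) = characteristic (R Quot M 1)" if "i \<in> {1..n}" for i
      using that by (meson atLeastAtMost_iff order_refl order_trans)
    from small_subset_sum_Units[OF _ M this _ assms(4,5)]
    show "\<exists>S\<subseteq>{1..m}. card S \<le> n \<and> (\<Oplus>\<^bsub>R\<^esub>i\<in>S. a i) \<in> Units R"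
      by simp
  }
  {
    assume "\<exists>K. subfield K R"
    then obtain K where K: "subfield K R" ..
    have "characteristic (R Quot M i) = characteristic R" if "i \<in> {1..n}" for i
    proof -
      interpret maximalideal "M i" R using M that by blast
      show ?thesis
        using characteristic_Quot_subfield[OF K is_ideal] one_imp_carrier I_notcarr by blast
    qed
    then show "\<forall>i\<in>{1..n}. \<forall>j\<in>{1..n}. characteristic (R Quot M i) = characteristic (R Quot M j)"
      by simp
  }
qed

end
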